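(* Let $\mathcal X$ be a nonempty convex subset of a Euclidean space $E$, and let $F_1,\dots,F_K$ be continuous monotone vector fields on $\mathcal X$ with $(F_k,\mathcal X)$ admitting $\mathcal K$-representations $$X_kx+G_kg+tT_k+U_ku_k\leq_{\mathbf K_k}a_k,\quad 1\leq k\leq K\qquad[\mathbf K_k\in\mathcal K].$$ Let $\alpha_k>0$ and $F(x)=\sum_k\alpha_kF_k(x):\mathcal X\to E$. Then the conic constraint $$X_kx+G_kg_k+t_kT_k+U_ku_k\leq_{\mathbf K_k}a_k,\ 1\leq k\leq K,\qquad g=\sum_k\alpha_kg_k,\qquad t=\sum_k\alpha_kt_k$$ in variables $t,g,x,\{t_k,g_k,u_k,k\leq K\}$ is a $\mathcal K$-representation of $(F,\mathcal X)$. If the given constraints are almost $\mathcal K$-representations of $(F_k,\mathcal X)$, then the resulting constraint is an almost $\mathcal K$-representation of $(F,\mathcal X)$.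
   Context: $\mathcal K$ is a fixed family of regular cones (closed, convex, pointed, with nonempty interior) in Euclidean spaces which contains $\mathbb R_+$, is closed under finite direct products, and is closed under passing to dual cones. $a\leq_{\mathbf K}b$ means $b-a\in\mathbf K$. Finite systems of conic constraints with cones from $\mathcal K$, linear equalities and nonstrict linear inequalities are equivalent to a single conic constraint with a cone from $\mathcal K$. Let $\mathcal X$ be a nonempty convex subset of a Euclidean space $E$. A vector field $F:\mathcal X\to E$ is monotone if $\langle F(x)-F(y),x-y\rangle\geq0$ for all $x,y\in\mathcal X$. For continuous monotone $F$ put $$\mathcal F[F,\mathcal X]=\{[t;g;x]\in\mathbb R\times E\times E: x\in\mathcal X,\ t-\langle g,y\rangle\geq\langle F(y),x-y\rangle\ \forall y\in\mathcal X\}.$$ A conic constraint $Xx+Gg+tT+Uu\leq_{\mathbf K}a$, $\mathbf K\in\mathcal K$ (or an equivalent finite system), in variables $t,g,x$ and additional variables $u$, with projection $\mathcal T$ of its solution set on the space of $[t;g;x]$, is a $\mathcal K$-representation of $(F,\mathcal X)$ if (i) $\mathcal T\subset\mathcal F[F,\mathcal X]$ and $[t;g;x]\in\mathcal T$, $t'\geq t$ imply $[t';g;x]\in\mathcal T$; and (ii) $\mathcal T\supset\{[\langle F(x),x\rangle;F(x);x]:x\in\mathcal X\}$. It is an almost $\mathcal K$-representation if (i) holds and (ii') $\mathcal T\supset\{[t;F(x);x]:x\in\mathcal X,\ t>\langle F(x),x\rangle\}$. *)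

theory Defs
  imports "HOL-Analysis.Analysis" "HOL-Library.Function_Algebras"
begin

text \<open>
  The cones of the family live in spaces of varying dimension. The space \<open>\<real>\<^sup>n\<close> is
  \<open>topspace (Euclidean_space n)\<close>, the functions \<open>nat \<Rightarrow> real\<close> vanishing at all indices
  \<open>\<ge> n\<close>, with the topology \<open>Euclidean_space n\<close> and the pointwise vector space operations.
\<close>

instantiation "fun" :: (type, real_vector) real_vector
begin

definition scaleR_fun_def: "c *\<^sub>R f = (\<lambda>x. c *\<^sub>R f x)"

instance
  by standard (simp_all add: scaleR_fun_def fun_eq_iff scaleR_add_right scaleR_add_left)

end

type_synonym rvec = "nat \<Rightarrow> real"

abbreviation Rn :: "nat \<Rightarrow> rvec set"
  where "Rn n \<equiv> topspace (Euclidean_space n)"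

definition regular_cone :: "nat \<Rightarrow> rvec set \<Rightarrow> bool"
  where "regular_cone n K \<longleftrightarrow>
    K \<subseteq> Rn n \<and> convex_cone K \<and> closedin (Euclidean_space n) K \<and>
    (\<forall>z. z \<in> K \<and> - z \<in> K \<longrightarrow> z = 0) \<and>
    Euclidean_space n interior_of K \<noteq> {}"

definition nonneg_ray :: "rvec set"
  where "nonneg_ray = {z \<in> Rn 1. 0 \<le> z 0}"

text \<open>\<open>\<real>\<^sup>n \<times> \<real>\<^sup>m\<close> is identified with \<open>\<real>\<^sup>n\<^sup>+\<^sup>m\<close> by concatenation of coordinates.\<close>

definition cone_prod :: "nat \<Rightarrow> rvec set \<Rightarrow> nat \<Rightarrow> rvec set \<Rightarrow> rvec set"
  where "cone_prod n K m L =
    {z \<in> Rn (n + m). (\<lambda>i. if i < n then z i else 0) \<in> K \<and> (\<lambda>i. z (n + i)) \<in> L}"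

definition dual_cone :: "nat \<Rightarrow> rvec set \<Rightarrow> rvec set"
  where "dual_cone n K = {y \<in> Rn n. \<forall>z\<in>K. (\<Sum>i<n. y i * z i) \<ge> 0}"

text \<open>A member \<open>(n, K)\<close> of the family is a cone \<open>K\<close> in \<open>\<real>\<^sup>n\<close>.\<close>

definition cone_family :: "(nat \<times> rvec set) set \<Rightarrow> bool"
  where "cone_family \<K> \<longleftrightarrow>
    (\<forall>(n, K)\<in>\<K>. regular_cone n K) \<and>
    (1, nonneg_ray) \<in> \<K> \<and>
    (\<forall>(n, K)\<in>\<K>. \<forall>(m, L)\<in>\<K>. (n + m, cone_prod n K m L) \<in> \<K>) \<and>
    (\<forall>(n, K)\<in>\<K>. (n, dual_cone n K) \<in> \<K>)"

definition cone_le :: "rvec set \<Rightarrow> rvec \<Rightarrow> rvec \<Rightarrow> bool"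
  where "cone_le K a b \<longleftrightarrow> b - a \<in> K"

definition finite_dim_subspace :: "'w::real_vector set \<Rightarrow> bool"
  where "finite_dim_subspace W \<longleftrightarrow> (\<exists>B. finite B \<and> span B = W)"

text \<open>
  Data of a conic constraint \<open>X x + G g + t T + U u \<le>\<^sub>K a\<close> in variables \<open>t \<in> \<real>\<close>,
  \<open>g, x \<in> E\<close> and additional variables \<open>u\<close> ranging over a finite-dimensional space \<open>W\<close>.
  Only the values of \<open>U\<close> on \<open>W\<close> matter; a linear map on \<open>W\<close> always extends linearly
  to the whole type.
\<close>

definition conic_data ::
    "(nat \<times> rvec set) set \<Rightarrow> 'w::real_vector set \<Rightarrow> nat \<Rightarrow> rvec set \<Rightarrow>
     ('e::euclidean_space \<Rightarrow> rvec) \<Rightarrow> ('e \<Rightarrow> rvec) \<Rightarrow> rvec \<Rightarrow> ('w \<Rightarrow> rvec) \<Rightarrow> rvec \<Rightarrow> bool"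
  where "conic_data \<K> W n K X G T U a \<longleftrightarrow>
    finite_dim_subspace W \<and> (n, K) \<in> \<K> \<and>
    linear X \<and> range X \<subseteq> Rn n \<and>
    linear G \<and> range G \<subseteq> Rn n \<and>
    T \<in> Rn n \<and>
    linear U \<and> U ` W \<subseteq> Rn n \<and>
    a \<in> Rn n"

definition conic_solutions ::
    "'w::real_vector set \<Rightarrow> rvec set \<Rightarrow>
     ('e::euclidean_space \<Rightarrow> rvec) \<Rightarrow> ('e \<Rightarrow> rvec) \<Rightarrow> rvec \<Rightarrow> ('w \<Rightarrow> rvec) \<Rightarrow> rvec \<Rightarrow>
     (real \<times> 'e \<times> 'e \<times> 'w) set"
  where "conic_solutions W K X G T U a =
    {(t, g, x, u). u \<in> W \<and> cone_le K (X x + G g + t *\<^sub>R T + U u) a}"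

text \<open>
  The solution set, in the space of all variables, of a finite system that is equivalent to
  a single conic constraint with a cone from the family.
\<close>

definition equivalent_to_conic ::
    "(nat \<times> rvec set) set \<Rightarrow> 'w::real_vector set \<Rightarrow>
     (real \<times> 'e::euclidean_space \<times> 'e \<times> 'w) set \<Rightarrow> bool"
  where "equivalent_to_conic \<K> W S \<longleftrightarrow>
    (\<exists>n K X G T U a. conic_data \<K> W n K X G T U a \<and> S = conic_solutions W K X G T U a)"

definition monotone_field :: "'e::euclidean_space set \<Rightarrow> ('e \<Rightarrow> 'e) \<Rightarrow> bool"
  where "monotone_field \<X> F \<longleftrightarrow> (\<forall>x\<in>\<X>. \<forall>y\<in>\<X>. (F x - F y) \<bullet> (x - y) \<ge> 0)"

definition field_set ::
    "'e::euclidean_space set \<Rightarrow> ('e \<Rightarrow> 'e) \<Rightarrow> (real \<times> 'e \<times> 'e) set"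
  where "field_set \<X> F =
    {(t, g, x). x \<in> \<X> \<and> (\<forall>y\<in>\<X>. t - g \<bullet> y \<ge> F y \<bullet> (x - y))}"

definition proj_tgx ::
    "(real \<times> 'e \<times> 'e \<times> 'w) set \<Rightarrow> (real \<times> 'e \<times> 'e) set"
  where "proj_tgx S = {(t, g, x). \<exists>u. (t, g, x, u) \<in> S}"

text \<open>
  In the next three definitions \<open>S\<close> is the solution set of the constraint (or system), and
  \<open>W\<close> is the space of its additional variables. The first one is condition (i), together
  with the requirements under which representations of \<open>(F, \<X>)\<close> are considered at all.
\<close>

definition pre_representation ::
    "(nat \<times> rvec set) set \<Rightarrow> 'e::euclidean_space set \<Rightarrow> ('e \<Rightarrow> 'e) \<Rightarrow>
     'w::real_vector set \<Rightarrow> (real \<times> 'e \<times> 'e \<times> 'w) set \<Rightarrow> bool"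
  where "pre_representation \<K> \<X> F W S \<longleftrightarrow>
    \<X> \<noteq> {} \<and> convex \<X> \<and> continuous_on \<X> F \<and> monotone_field \<X> F \<and>
    equivalent_to_conic \<K> W S \<and>
    proj_tgx S \<subseteq> field_set \<X> F \<and>
    (\<forall>t g x t'. (t, g, x) \<in> proj_tgx S \<and> t' \<ge> t \<longrightarrow> (t', g, x) \<in> proj_tgx S)"

definition K_representation ::
    "(nat \<times> rvec set) set \<Rightarrow> 'e::euclidean_space set \<Rightarrow> ('e \<Rightarrow> 'e) \<Rightarrow>
     'w::real_vector set \<Rightarrow> (real \<times> 'e \<times> 'e \<times> 'w) set \<Rightarrow> bool"
  where "K_representation \<K> \<X> F W S \<longleftrightarrow>
    pre_representation \<K> \<X> F W S \<and>
    {(F x \<bullet> x, F x, x) | x. x \<in> \<X>} \<subseteq> proj_tgx S"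

definition almost_K_representation ::
    "(nat \<times> rvec set) set \<Rightarrow> 'e::euclidean_space set \<Rightarrow> ('e \<Rightarrow> 'e) \<Rightarrow>
     'w::real_vector set \<Rightarrow> (real \<times> 'e \<times> 'e \<times> 'w) set \<Rightarrow> bool"
  where "almost_K_representation \<K> \<X> F W S \<longleftrightarrow>
    pre_representation \<K> \<X> F W S \<and>
    {(t, F x, x) | t x. x \<in> \<X> \<and> t > F x \<bullet> x} \<subseteq> proj_tgx S"

text \<open>
  The additional variables of the combined system: a family \<open>w\<close> with
  \<open>w k = (t\<^sub>k, g\<^sub>k, u\<^sub>k)\<close>, \<open>u\<^sub>k \<in> \<real>\<^bsup>m k\<^esup>\<close>, for \<open>1 \<le> k \<le> N\<close>,
  normalised to zero at the other indices.
\<close>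

definition sum_vars :: "nat \<Rightarrow> (nat \<Rightarrow> nat) \<Rightarrow> (nat \<Rightarrow> real \<times> 'e::euclidean_space \<times> rvec) set"
  where "sum_vars N m =
    {w. (\<forall>k\<in>{1..N}. snd (snd (w k)) \<in> Rn (m k)) \<and> (\<forall>k. k \<notin> {1..N} \<longrightarrow> w k = 0)}"

definition sum_system ::
    "nat \<Rightarrow> (nat \<Rightarrow> real) \<Rightarrow> (nat \<Rightarrow> nat) \<Rightarrow> (nat \<Rightarrow> rvec set) \<Rightarrow>
     (nat \<Rightarrow> 'e::euclidean_space \<Rightarrow> rvec) \<Rightarrow> (nat \<Rightarrow> 'e \<Rightarrow> rvec) \<Rightarrow> (nat \<Rightarrow> rvec) \<Rightarrow>
     (nat \<Rightarrow> rvec \<Rightarrow> rvec) \<Rightarrow> (nat \<Rightarrow> rvec) \<Rightarrow>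
     (real \<times> 'e \<times> 'e \<times> (nat \<Rightarrow> real \<times> 'e \<times> rvec)) set"
  where "sum_system N \<alpha> m K X G T U a =
    {(t, g, x, w). w \<in> sum_vars N m \<and>
      (\<forall>k\<in>{1..N}. case w k of (t\<^sub>k, g\<^sub>k, u\<^sub>k) \<Rightarrow>
         cone_le (K k) (X k x + G k g\<^sub>k + t\<^sub>k *\<^sub>R T k + U k u\<^sub>k) (a k)) \<and>
      g = (\<Sum>k=1..N. \<alpha> k *\<^sub>R fst (snd (w k))) \<and>
      t = (\<Sum>k=1..N. \<alpha> k * fst (w k))}"

end

(*
  Conditions (i), (ii) and (ii') are termwise: the defining inequalities of the sets field_set are
  added with weights alpha_k, and any excess in t is put into one or all of the t_k.
  The combined system is one conic constraint because solution sets of conic constraints are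
  closed under linear preimages and finite intersections (products of cones), and a linear
  equation is a pair of inequalities with cone R_+.
*)
theory Submission
  imports Defs
begin

section \<open>Solution sets of conic constraints and their closure properties\<close>

text \<open>A conic constraint with the variables not yet split into \<open>t\<close>,
  \<open>g\<close>, \<open>x\<close>, \<open>u\<close>: one linear map \<open>L\<close> acts on all
  of them, and \<open>V\<close> is the set they range over. Intersections and preimages are easiest
  to treat in this form; \<open>conic_set_imp_equivalent_to_conic\<close> restores the
  split.\<close>

definition conic_set ::
    "(nat \<times> rvec set) set \<Rightarrow> 'v::real_vector set \<Rightarrow> 'v set \<Rightarrow> bool"
  where "conic_set \<K> V S \<longleftrightarrow>
    (\<exists>n K L a. (n, K) \<in> \<K> \<and> linear L \<and> L ` V \<subseteq> Rn n \<and> a \<in> Rn n \<and>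
       S = {v \<in> V. a - L v \<in> K})"

lemma mem_Rn: "z \<in> Rn n \<longleftrightarrow> (\<forall>i\<ge>n. z i = 0)"
  by (simp add: topspace_Euclidean_space)

lemma minus_mem_Rn: "a \<in> Rn n \<Longrightarrow> b \<in> Rn n \<Longrightarrow> a - b \<in> Rn n"
  by (simp add: mem_Rn)

text \<open>For \<open>u\<close> in \<open>Rn n\<close> and \<open>v\<close> in \<open>Rn m\<close>
  this is the pair of \<open>u\<close> and \<open>v\<close> under the identification of the product
  space with \<open>Rn (n + m)\<close> used in \<open>cone_prod\<close>.\<close>

definition rvec_append :: "nat \<Rightarrow> rvec \<Rightarrow> rvec \<Rightarrow> rvec"
  where "rvec_append n u v = (\<lambda>i. if i < n then u i else v (i - n))"

lemma rvec_append_diff: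
  "rvec_append n a b - rvec_append n u v = rvec_append n (a - u) (b - v)"
  by (auto simp: rvec_append_def fun_eq_iff)

lemma rvec_append_mem_Rn: "v \<in> Rn m \<Longrightarrow> rvec_append n u v \<in> Rn (n + m)"
  by (auto simp: rvec_append_def mem_Rn)

text \<open>The two projections in \<open>cone_prod\<close> undo the concatenation; for the first
  one this uses that \<open>u\<close> vanishes from index \<open>n\<close> on.\<close>

lemma rvec_append_mem_cone_prod:
  assumes "u \<in> Rn n" "v \<in> Rn m"
  shows "rvec_append n u v \<in> cone_prod n K m L \<longleftrightarrow> u \<in> K \<and> v \<in> L"
proof -
  have "(\<lambda>i. if i < n then rvec_append n u v i else 0) = u"
    using assms(1) by (auto simp: rvec_append_def mem_Rn fun_eq_iff)
  moreover have "(\<lambda>i. rvec_append n u v (n + i)) = v"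
    by (auto simp: rvec_append_def)
  ultimately show ?thesis
    using rvec_append_mem_Rn[OF assms(2), of n u] by (simp add: cone_prod_def)
qed

lemma linear_rvec_append:
  assumes "linear L" "linear M"
  shows "linear (\<lambda>v. rvec_append n (L v) (M v))"
proof (rule linearI)
  show "rvec_append n (L (x + y)) (M (x + y)) =
      rvec_append n (L x) (M x) + rvec_append n (L y) (M y)" for x y
    by (auto simp: rvec_append_def fun_eq_iff linear_add[OF assms(1)] linear_add[OF assms(2)])
  show "rvec_append n (L (c *\<^sub>R x)) (M (c *\<^sub>R x)) = c *\<^sub>R rvec_append n (L x) (M x)" for c x
    by (auto simp: rvec_append_def fun_eq_iff scaleR_fun_def
        linear_scale[OF assms(1)] linear_scale[OF assms(2)])
qed

text \<open>Stacking the two constraints gives one constraint whose cone is the product of the two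
  cones, again a member of the family.\<close>

lemma conic_set_Int:
  assumes "cone_family \<K>" "conic_set \<K> V S" "conic_set \<K> V S'"
  shows "conic_set \<K> V (S \<inter> S')"
proof -
  obtain n K L a where 1: "(n, K) \<in> \<K>" "linear L" "L ` V \<subseteq> Rn n" "a \<in> Rn n"
    "S = {v \<in> V. a - L v \<in> K}"
    using assms(2) unfolding conic_set_def by blast
  obtain m K' M b where 2: "(m, K') \<in> \<K>" "linear M" "M ` V \<subseteq> Rn m" "b \<in> Rn m"
    "S' = {v \<in> V. b - M v \<in> K'}"
    using assms(3) unfolding conic_set_def by blast
  have "(n + m, cone_prod n K m K') \<in> \<K>"
    using assms(1) 1(1) 2(1) unfolding cone_family_def by blast
  moreover have "(\<lambda>v. rvec_append n (L v) (M v)) ` V \<subseteq> Rn (n + m)"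
    using 2(3) rvec_append_mem_Rn by blast
  moreover have "rvec_append n a b - rvec_append n (L v) (M v) \<in> cone_prod n K m K' \<longleftrightarrow>
      a - L v \<in> K \<and> b - M v \<in> K'" if "v \<in> V" for v
    unfolding rvec_append_diff using that 1(3,4) 2(3,4)
    by (intro rvec_append_mem_cone_prod minus_mem_Rn) auto
  then have "S \<inter> S' =
      {v \<in> V. rvec_append n a b - rvec_append n (L v) (M v) \<in> cone_prod n K m K'}"
    unfolding 1(5) 2(5) by blast
  ultimately show ?thesis
    unfolding conic_set_def
    using linear_rvec_append[OF 1(2) 2(2)] rvec_append_mem_Rn[OF 2(4)] by blast
qed

text \<open>The functional is placed in coordinate 0 of a vector of \<open>Rn 1\<close>, so that the
  constraint has cone \<open>nonneg_ray\<close> and right-hand side 0.\<close>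

lemma conic_set_halfspace:
  fixes f :: "'v::real_vector \<Rightarrow> real"
  assumes "cone_family \<K>" "linear f"
  shows "conic_set \<K> V {v \<in> V. f v \<le> 0}"
proof -
  define L :: "'v \<Rightarrow> rvec" where "L v = (\<lambda>i. if i = 0 then f v else 0)" for v
  have "linear L"
    by (rule linearI)
      (auto simp: L_def fun_eq_iff scaleR_fun_def linear_add[OF assms(2)] linear_scale[OF assms(2)])
  moreover have "L ` V \<subseteq> Rn 1" "(0 :: rvec) \<in> Rn 1"
    by (auto simp: L_def mem_Rn)
  moreover have "{v \<in> V. f v \<le> 0} = {v \<in> V. 0 - L v \<in> nonneg_ray}"
    by (auto simp: L_def nonneg_ray_def mem_Rn)
  moreover have "(1, nonneg_ray) \<in> \<K>"
    using assms(1) unfolding cone_family_def by blast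
  ultimately show ?thesis
    unfolding conic_set_def by blast
qed

lemma conic_set_hyperplane:
  fixes f :: "'v::real_vector \<Rightarrow> real"
  assumes "cone_family \<K>" "linear f"
  shows "conic_set \<K> V {v \<in> V. f v = 0}"
proof -
  have "conic_set \<K> V ({v \<in> V. f v \<le> 0} \<inter> {v \<in> V. - f v \<le> 0})"
    using assms by (intro conic_set_Int conic_set_halfspace linear_compose_neg)
  also have "{v \<in> V. f v \<le> 0} \<inter> {v \<in> V. - f v \<le> 0} = {v \<in> V. f v = 0}"
    by auto
  finally show ?thesis .
qed

lemma conic_set_INT:
  assumes "cone_family \<K>" "finite I" "\<And>i. i \<in> I \<Longrightarrow> conic_set \<K> V (S i)"
  shows "conic_set \<K> V {v \<in> V. \<forall>i\<in>I. v \<in> S i}"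
  using assms(2,3)
proof (induction I rule: finite_induct)
  case empty
  \<comment> \<open>The intersection over no indices is \<open>V\<close> itself, which is conic as
    the zero set of the zero functional.\<close>
  show ?case
    using conic_set_hyperplane[OF assms(1), of "\<lambda>_. 0" V] linear_zero by auto
next
  case (insert i I)
  have "conic_set \<K> V (S i \<inter> {v \<in> V. \<forall>i\<in>I. v \<in> S i})"
    using insert by (intro conic_set_Int[OF assms(1)]) auto
  also have "S i \<inter> {v \<in> V. \<forall>i\<in>I. v \<in> S i} = {v \<in> V. \<forall>i\<in>insert i I. v \<in> S i}"
    by auto
  finally show ?case .
qed

text \<open>A vector equation is a system of scalar equations, one for each of the finitely many
  elements of \<open>Basis\<close>.\<close>

lemma conic_set_kernel:
  fixes f :: "'v::real_vector \<Rightarrow> 'e::euclidean_space"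
  assumes "cone_family \<K>" "linear f"
  shows "conic_set \<K> V {v \<in> V. f v = 0}"
proof -
  have "conic_set \<K> V {v \<in> V. \<forall>b\<in>Basis. v \<in> {v \<in> V. f v \<bullet> b = 0}}"
  proof (intro conic_set_INT[OF assms(1)] conic_set_hyperplane[OF assms(1)])
    show "linear (\<lambda>v. f v \<bullet> b)" for b
      by (rule linearI)
        (simp_all add: linear_add[OF assms(2)] linear_scale[OF assms(2)] inner_add_left)
  qed simp
  also have "{v \<in> V. \<forall>b\<in>Basis. v \<in> {v \<in> V. f v \<bullet> b = 0}} = {v \<in> V. f v = 0}"
    by (auto simp: euclidean_all_zero_iff)
  finally show ?thesis .
qed

text \<open>The cone and the right-hand side stay the same, and \<open>L\<close> is replaced by
  \<open>L \<circ> h\<close>.\<close>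

lemma conic_set_preimage:
  assumes "conic_set \<K> V S" "linear h" "h ` V' \<subseteq> V"
  shows "conic_set \<K> V' {v \<in> V'. h v \<in> S}"
proof -
  obtain n K L a where *: "(n, K) \<in> \<K>" "linear L" "L ` V \<subseteq> Rn n" "a \<in> Rn n"
    "S = {v \<in> V. a - L v \<in> K}"
    using assms(1) unfolding conic_set_def by blast
  have "{v \<in> V'. h v \<in> S} = {v \<in> V'. a - (L \<circ> h) v \<in> K}"
    using assms(3) by (auto simp: *(5))
  moreover have "(L \<circ> h) ` V' \<subseteq> Rn n"
    using assms(3) *(3) by (simp add: image_comp [symmetric]) blast
  ultimately show ?thesis
    unfolding conic_set_def using * linear_compose[OF assms(2) *(2)] by blast
qed

section \<open>Passage between the unsplit form and the data \<open>X\<close>, \<open>G\<close>,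
  \<open>T\<close>, \<open>U\<close>\<close>

lemma conic_set_conic_solutions:
  fixes X G :: "'e::euclidean_space \<Rightarrow> rvec" and U :: "'w::real_vector \<Rightarrow> rvec"
  assumes "conic_data \<K> W n K X G T U a"
  shows "conic_set \<K> (UNIV \<times> UNIV \<times> UNIV \<times> W) (conic_solutions W K X G T U a)"
proof -
  define L :: "real \<times> 'e \<times> 'e \<times> 'w \<Rightarrow> rvec"
    where "L = (\<lambda>(t, g, x, u). X x + G g + t *\<^sub>R T + U u)"
  note d = assms[unfolded conic_data_def]
  have lin: "linear X" "linear G" "linear U"
    using d by auto
  have "linear L"
    by (rule linearI)
      (auto simp: L_def lin[THEN linear_add] lin[THEN linear_scale] scaleR_add_left
        scaleR_add_right)
  moreover have "X x \<in> Rn n" "G g \<in> Rn n" "T \<in> Rn n" for x g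
    using d by auto
  moreover have "U u \<in> Rn n" if "u \<in> W" for u
    using d that by auto
  ultimately have "linear L" "L ` (UNIV \<times> UNIV \<times> UNIV \<times> W) \<subseteq> Rn n"
    by (auto simp: L_def mem_Rn scaleR_fun_def)
  moreover have "conic_solutions W K X G T U a = {v \<in> UNIV \<times> UNIV \<times> UNIV \<times> W. a - L v \<in> K}"
    by (auto simp: conic_solutions_def cone_le_def L_def)
  ultimately show ?thesis
    unfolding conic_set_def using d by blast
qed

text \<open>By linearity \<open>L\<close> is the sum of its restrictions to the four factors: these
  are \<open>X\<close>, \<open>G\<close>, \<open>U\<close>, and for the scalar variable the
  multiples of its value \<open>T\<close> at \<open>t = 1\<close>.\<close>

lemma conic_set_imp_equivalent_to_conic:
  fixes W :: "'w::real_vector set" and S :: "(real \<times> 'e::euclidean_space \<times> 'e \<times> 'w) set"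
  assumes "finite_dim_subspace W" "conic_set \<K> (UNIV \<times> UNIV \<times> UNIV \<times> W) S"
  shows "equivalent_to_conic \<K> W S"
proof -
  obtain n K L a where *: "(n, K) \<in> \<K>" "linear L"
    "L ` (UNIV \<times> UNIV \<times> UNIV \<times> W) \<subseteq> Rn n" "a \<in> Rn n"
    "S = {v \<in> UNIV \<times> UNIV \<times> UNIV \<times> W. a - L v \<in> K}"
    using assms(2) unfolding conic_set_def by blast
  \<comment> \<open>\<open>L\<close> is known to map into \<open>Rn n\<close> only where the last
    component lies in \<open>W\<close>; the points defining \<open>X\<close>, \<open>G\<close> and
    \<open>T\<close> have last component 0.\<close>
  have "0 \<in> W"
    using assms(1) unfolding finite_dim_subspace_def by (auto intro: span_zero)
  define X where "X x = L (0, 0, x, 0)" for x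
  define G where "G g = L (0, g, 0, 0)" for g
  define T where "T = L (1, 0, 0, 0)"
  define U where "U u = L (0, 0, 0, u)" for u
  have "linear X" "linear G" "linear U"
    unfolding X_def G_def U_def
    by (auto intro!: linearI simp flip: linear_add[OF *(2)] linear_scale[OF *(2)])
  moreover have "L (t, g, x, u) \<in> Rn n" if "u \<in> W" for t g x u
    using *(3) that by auto
  then have "range X \<subseteq> Rn n" "range G \<subseteq> Rn n" "T \<in> Rn n" "U ` W \<subseteq> Rn n"
    unfolding X_def G_def T_def U_def image_subset_iff using \<open>0 \<in> W\<close> by simp_all
  ultimately have "conic_data \<K> W n K X G T U a"
    using *(1,4) assms(1) unfolding conic_data_def by blast
  moreover have "L (t, g, x, u) = X x + G g + t *\<^sub>R T + U u" for t g x u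
    unfolding X_def G_def U_def T_def
    by (simp flip: linear_add[OF *(2)] linear_scale[OF *(2)])
  then have "S = conic_solutions W K X G T U a"
    by (auto simp: *(5) conic_solutions_def cone_le_def)
  ultimately show ?thesis
    unfolding equivalent_to_conic_def by blast
qed

section \<open>Finite dimension of the space of additional variables\<close>

lemma finite_dim_subspace_image:
  assumes "finite_dim_subspace W" "linear h"
  shows "finite_dim_subspace (h ` W)"
  using assms linear_span_image[OF assms(2)] unfolding finite_dim_subspace_def
  by (metis finite_imageI)

lemma finite_dim_subspace_sum:
  assumes "finite_dim_subspace V" "finite_dim_subspace W"
  shows "finite_dim_subspace {v + w | v w. v \<in> V \<and> w \<in> W}"
proof -
  obtain A B where *: "finite A" "span A = V" "finite B" "span B = W"
    using assms unfolding finite_dim_subspace_def by blast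
  have "span (A \<union> B) = {v + w | v w. v \<in> V \<and> w \<in> W}"
    using *(2,4) by (auto simp: span_Un)
  then show ?thesis
    using *(1,3) unfolding finite_dim_subspace_def by blast
qed

text \<open>The product is the sum of the images of its factors under the two coordinate
  embeddings.\<close>

lemma finite_dim_subspace_Times:
  assumes "finite_dim_subspace V" "finite_dim_subspace W"
  shows "finite_dim_subspace (V \<times> W)"
proof -
  have "0 \<in> V" "0 \<in> W"
    using assms unfolding finite_dim_subspace_def by (auto intro: span_zero)
  then have "V \<times> W = {v + w | v w. v \<in> (\<lambda>x. (x, 0)) ` V \<and> w \<in> Pair 0 ` W}"
    by (auto simp: image_iff)
  moreover have "finite_dim_subspace {v + w | v w. v \<in> (\<lambda>x. (x, 0)) ` V \<and> w \<in> Pair 0 ` W}"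
    using assms
    by (intro finite_dim_subspace_sum finite_dim_subspace_image) (auto intro: linearI)
  ultimately show ?thesis
    by simp
qed

lemma finite_dim_subspace_UNIV: "finite_dim_subspace (UNIV :: 'e::euclidean_space set)"
  unfolding finite_dim_subspace_def using finite_Basis span_Basis by blast

text \<open>Induction on \<open>N\<close>: the block with index \<open>Suc N\<close> splits off as a
  direct summand, embedded by \<open>inj\<close>.\<close>

lemma finite_dim_subspace_sum_vars:
  assumes "\<And>k. k \<in> {1..N} \<Longrightarrow> finite_dim_subspace (Rn (m k))"
  shows "finite_dim_subspace (sum_vars N m :: (nat \<Rightarrow> real \<times> 'e::euclidean_space \<times> rvec) set)"
  using assms
proof (induction N)
  case 0
  \<comment> \<open>\<open>{1..0}\<close> is empty, so the normalisation leaves only the zero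
    family; without it this space would not be finite-dimensional.\<close>
  have "sum_vars 0 m = ({0} :: (nat \<Rightarrow> real \<times> 'e \<times> rvec) set)"
    by (auto simp: sum_vars_def)
  then show ?case
    unfolding finite_dim_subspace_def by (metis finite.emptyI span_empty)
next
  case (Suc N)
  define inj :: "real \<times> 'e \<times> rvec \<Rightarrow> nat \<Rightarrow> real \<times> 'e \<times> rvec"
    where "inj p = (\<lambda>k. if k = Suc N then p else 0)" for p
  have "linear inj"
    by (rule linearI) (auto simp: inj_def fun_eq_iff scaleR_fun_def)
  have "finite_dim_subspace {v + w | v w. v \<in> (sum_vars N m :: (nat \<Rightarrow> real \<times> 'e \<times> rvec) set) \<and>
      w \<in> inj ` (UNIV \<times> UNIV \<times> Rn (m (Suc N)))}"
    using Suc.prems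
    by (intro finite_dim_subspace_sum finite_dim_subspace_image[OF _ \<open>linear inj\<close>]
        finite_dim_subspace_Times finite_dim_subspace_UNIV Suc.IH) auto
  also have "{v + w | v w. v \<in> (sum_vars N m :: (nat \<Rightarrow> real \<times> 'e \<times> rvec) set) \<and>
      w \<in> inj ` (UNIV \<times> UNIV \<times> Rn (m (Suc N)))} = sum_vars (Suc N) m" (is "?L = _")
  proof (intro equalityI subsetI)
    fix z assume "z \<in> ?L"
    then show "z \<in> sum_vars (Suc N) m"
      by (auto simp: sum_vars_def inj_def)
  next
    fix z :: "nat \<Rightarrow> real \<times> 'e \<times> rvec" assume z: "z \<in> sum_vars (Suc N) m"
    have "z = z(Suc N := 0) + inj (z (Suc N))"
      by (auto simp: inj_def fun_eq_iff)
    moreover have "z(Suc N := 0) \<in> sum_vars N m"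
      using z by (auto simp: sum_vars_def)
    moreover have "inj (z (Suc N)) \<in> inj ` (UNIV \<times> UNIV \<times> Rn (m (Suc N)))"
      using z by (intro imageI) (auto simp: sum_vars_def mem_Times_iff)
    ultimately show "z \<in> ?L"
      unfolding mem_Collect_eq by (intro exI conjI)
  qed
  finally show ?case .
qed

section \<open>The combined system as a single conic constraint\<close>

lemma equivalent_to_conic_sum_system:
  fixes X G :: "nat \<Rightarrow> 'e::euclidean_space \<Rightarrow> rvec"
  assumes "cone_family \<K>"
    and data: "\<And>k. k \<in> {1..N} \<Longrightarrow>
      conic_data \<K> (Rn (m k)) (n k) (K k) (X k) (G k) (T k) (U k) (a k)"
  shows "equivalent_to_conic \<K> (sum_vars N m) (sum_system N \<alpha> m K X G T U a)"
proof (rule conic_set_imp_equivalent_to_conic)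
  show "finite_dim_subspace (sum_vars N m :: (nat \<Rightarrow> real \<times> 'e \<times> rvec) set)"
    using data by (intro finite_dim_subspace_sum_vars) (auto simp: conic_data_def)
next
  let ?V = "UNIV \<times> UNIV \<times> UNIV \<times> sum_vars N m ::
    (real \<times> 'e \<times> 'e \<times> (nat \<Rightarrow> real \<times> 'e \<times> rvec)) set"
  let ?C = "\<lambda>k. conic_solutions (Rn (m k)) (K k) (X k) (G k) (T k) (U k) (a k)"
  \<comment> \<open>\<open>h k\<close> selects the variables that the \<open>k\<close>-th constraint
    sees: its own block of \<open>w\<close> and the common \<open>x\<close>. The system is thus an
    intersection of preimages under the \<open>h k\<close> with the kernels of \<open>f\<close> and
    \<open>e\<close>, the defects of the equations for \<open>t\<close> and
    \<open>g\<close>.\<close>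
  define h :: "nat \<Rightarrow> real \<times> 'e \<times> 'e \<times> (nat \<Rightarrow> real \<times> 'e \<times> rvec) \<Rightarrow> real \<times> 'e \<times> 'e \<times> rvec"
    where "h k = (\<lambda>(t, g, x, w). (fst (w k), fst (snd (w k)), x, snd (snd (w k))))" for k
  define f :: "real \<times> 'e \<times> 'e \<times> (nat \<Rightarrow> real \<times> 'e \<times> rvec) \<Rightarrow> real"
    where "f = (\<lambda>(t, g, x, w). t - (\<Sum>k=1..N. \<alpha> k * fst (w k)))"
  define e :: "real \<times> 'e \<times> 'e \<times> (nat \<Rightarrow> real \<times> 'e \<times> rvec) \<Rightarrow> 'e"
    where "e = (\<lambda>(t, g, x, w). g - (\<Sum>k=1..N. \<alpha> k *\<^sub>R fst (snd (w k))))"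
  have "linear (h k)" for k
    by (rule linearI) (auto simp: h_def scaleR_fun_def)
  moreover have "h k ` ?V \<subseteq> UNIV \<times> UNIV \<times> UNIV \<times> Rn (m k)" if "k \<in> {1..N}" for k
    using that by (auto simp: h_def sum_vars_def)
  ultimately have "conic_set \<K> ?V {v \<in> ?V. h k v \<in> ?C k}" if "k \<in> {1..N}" for k
    using conic_set_preimage[OF conic_set_conic_solutions[OF data[OF that]]] that by blast
  then have "conic_set \<K> ?V {v \<in> ?V. \<forall>k\<in>{1..N}. v \<in> {v \<in> ?V. h k v \<in> ?C k}}"
    by (intro conic_set_INT[OF assms(1)] finite_atLeastAtMost)
  moreover have "linear f"
    by (rule linearI) (auto simp: f_def scaleR_fun_def algebra_simps sum.distrib sum_distrib_left)
  moreover have "linear e"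
    by (rule linearI)
      (auto simp: e_def scaleR_fun_def algebra_simps sum.distrib scaleR_sum_right)
  ultimately have "conic_set \<K> ?V ({v \<in> ?V. \<forall>k\<in>{1..N}. v \<in> {v \<in> ?V. h k v \<in> ?C k}} \<inter>
      ({v \<in> ?V. f v = 0} \<inter> {v \<in> ?V. e v = 0}))"
    using assms(1) by (intro conic_set_Int conic_set_kernel)
  also have "{v \<in> ?V. \<forall>k\<in>{1..N}. v \<in> {v \<in> ?V. h k v \<in> ?C k}} \<inter>
      ({v \<in> ?V. f v = 0} \<inter> {v \<in> ?V. e v = 0}) = sum_system N \<alpha> m K X G T U a"
    by (auto simp: h_def f_def e_def sum_system_def conic_solutions_def sum_vars_def
        case_prod_unfold)
  finally show "conic_set \<K> ?V (sum_system N \<alpha> m K X G T U a)" .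
qed

section \<open>Projection of the combined system and condition (i)\<close>

text \<open>Once \<open>x\<close> and all \<tau> and \<gamma> are fixed, the constraints share no
  variable, so each \<open>u\<close> can be eliminated separately. Conditions (i), (ii) and (ii')
  thereby reduce to the projections of the given systems.\<close>

lemma mem_proj_sum_system:
  "(t, g, x) \<in> proj_tgx (sum_system N \<alpha> m K X G T U a) \<longleftrightarrow>
    (\<exists>\<tau> \<gamma>. (\<forall>k\<in>{1..N}. (\<tau> k, \<gamma> k, x) \<in> proj_tgx
        (conic_solutions (Rn (m k)) (K k) (X k) (G k) (T k) (U k) (a k))) \<and>
      g = (\<Sum>k=1..N. \<alpha> k *\<^sub>R \<gamma> k) \<and> t = (\<Sum>k=1..N. \<alpha> k * \<tau> k))"
  (is "?l \<longleftrightarrow> ?r")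
proof
  assume ?l
  then obtain w where "(t, g, x, w) \<in> sum_system N \<alpha> m K X G T U a"
    by (auto simp: proj_tgx_def)
  then show ?r
    by (intro exI[of _ "\<lambda>k. fst (w k)"] exI[of _ "\<lambda>k. fst (snd (w k))"])
      (auto simp: proj_tgx_def sum_system_def sum_vars_def conic_solutions_def case_prod_unfold)
next
  assume ?r
  then obtain \<tau> \<gamma> where *: "\<forall>k\<in>{1..N}. \<exists>u. (\<tau> k, \<gamma> k, x, u) \<in>
      conic_solutions (Rn (m k)) (K k) (X k) (G k) (T k) (U k) (a k)"
    and eqs: "g = (\<Sum>k=1..N. \<alpha> k *\<^sub>R \<gamma> k)" "t = (\<Sum>k=1..N. \<alpha> k * \<tau> k)"
    by (auto simp: proj_tgx_def)
  obtain u where u: "\<forall>k\<in>{1..N}. (\<tau> k, \<gamma> k, x, u k) \<in>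
      conic_solutions (Rn (m k)) (K k) (X k) (G k) (T k) (U k) (a k)"
    using bchoice[OF *] by blast
  \<comment> \<open>The default 0 is the normalisation that \<open>sum_vars\<close> demands.\<close>
  define w where "w k = (if k \<in> {1..N} then (\<tau> k, \<gamma> k, u k) else 0)" for k
  have "(t, g, x, w) \<in> sum_system N \<alpha> m K X G T U a"
    using u by (auto simp: eqs sum_system_def sum_vars_def conic_solutions_def w_def)
  then show ?l
    by (auto simp: proj_tgx_def)
qed

lemma monotone_field_sum:
  assumes "\<And>k. k \<in> I \<Longrightarrow> monotone_field \<X> (F k)" "\<And>k. k \<in> I \<Longrightarrow> \<alpha> k \<ge> 0"
  shows "monotone_field \<X> (\<lambda>x. \<Sum>k\<in>I. \<alpha> k *\<^sub>R F k x)"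
  unfolding monotone_field_def
proof (intro ballI)
  fix x y assume "x \<in> \<X>" "y \<in> \<X>"
  have "((\<Sum>k\<in>I. \<alpha> k *\<^sub>R F k x) - (\<Sum>k\<in>I. \<alpha> k *\<^sub>R F k y)) \<bullet> (x - y) =
      (\<Sum>k\<in>I. \<alpha> k * ((F k x - F k y) \<bullet> (x - y)))"
    by (simp add: inner_sum_left flip: sum_subtractf scaleR_diff_right)
  also have "\<dots> \<ge> 0"
    using assms \<open>x \<in> \<X>\<close> \<open>y \<in> \<X>\<close> by (intro sum_nonneg mult_nonneg_nonneg) (auto simp: monotone_field_def)
  finally show "((\<Sum>k\<in>I. \<alpha> k *\<^sub>R F k x) - (\<Sum>k\<in>I. \<alpha> k *\<^sub>R F k y)) \<bullet> (x - y) \<ge> 0" .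
qed

text \<open>For fixed \<open>x\<close> and \<open>y\<close> the inequality defining
  \<open>field_set\<close> is linear in the triple of scalar, vector and field value, so nonnegative
  combinations preserve it. Any one index already yields \<open>x \<in> \<X>\<close>, hence
  \<open>I\<close> is nonempty.\<close>

lemma field_set_sum:
  assumes "I \<noteq> {}" "\<And>k. k \<in> I \<Longrightarrow> \<alpha> k \<ge> 0"
    and "\<And>k. k \<in> I \<Longrightarrow> (\<tau> k, \<gamma> k, x) \<in> field_set \<X> (F k)"
  shows "(\<Sum>k\<in>I. \<alpha> k * \<tau> k, \<Sum>k\<in>I. \<alpha> k *\<^sub>R \<gamma> k, x)
    \<in> field_set \<X> (\<lambda>x. \<Sum>k\<in>I. \<alpha> k *\<^sub>R F k x)"
proof -
  have "x \<in> \<X>"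
    using assms(1,3) by (auto simp: field_set_def)
  moreover have "(\<Sum>k\<in>I. \<alpha> k *\<^sub>R F k y) \<bullet> (x - y) \<le>
      (\<Sum>k\<in>I. \<alpha> k * \<tau> k) - (\<Sum>k\<in>I. \<alpha> k *\<^sub>R \<gamma> k) \<bullet> y" if "y \<in> \<X>" for y
  proof -
    have "(\<Sum>k\<in>I. \<alpha> k * (F k y \<bullet> (x - y))) \<le> (\<Sum>k\<in>I. \<alpha> k * (\<tau> k - \<gamma> k \<bullet> y))"
      using assms(2,3) that by (intro sum_mono mult_left_mono) (auto simp: field_set_def)
    then show ?thesis
      by (simp add: inner_sum_left right_diff_distrib sum_subtractf)
  qed
  ultimately show ?thesis
    by (auto simp: field_set_def)
qed

lemma pre_representation_sum_system:
  fixes X G :: "nat \<Rightarrow> 'e::euclidean_space \<Rightarrow> rvec"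
  assumes "cone_family \<K>" and "N \<ge> 1"
    and pos: "\<And>k. k \<in> {1..N} \<Longrightarrow> \<alpha> k > 0"
    and data: "\<And>k. k \<in> {1..N} \<Longrightarrow>
      conic_data \<K> (Rn (m k)) (n k) (K k) (X k) (G k) (T k) (U k) (a k)"
    and pre: "\<And>k. k \<in> {1..N} \<Longrightarrow> pre_representation \<K> \<X> (F k) (Rn (m k))
      (conic_solutions (Rn (m k)) (K k) (X k) (G k) (T k) (U k) (a k))"
  shows "pre_representation \<K> \<X> (\<lambda>x. \<Sum>k=1..N. \<alpha> k *\<^sub>R F k x) (sum_vars N m)
    (sum_system N \<alpha> m K X G T U a)"
proof -
  let ?S = "sum_system N \<alpha> m K X G T U a"
  let ?C = "\<lambda>k. conic_solutions (Rn (m k)) (K k) (X k) (G k) (T k) (U k) (a k)"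
  have one: "1 \<in> {1..N}"
    using \<open>N \<ge> 1\<close> by simp
  have "\<X> \<noteq> {}" "convex \<X>"
    using pre[OF one] by (auto simp: pre_representation_def)
  moreover have "continuous_on \<X> (\<lambda>x. \<Sum>k=1..N. \<alpha> k *\<^sub>R F k x)"
    using pre by (intro continuous_intros) (auto simp: pre_representation_def)
  moreover have "monotone_field \<X> (\<lambda>x. \<Sum>k=1..N. \<alpha> k *\<^sub>R F k x)"
    using pre pos by (intro monotone_field_sum) (auto simp: pre_representation_def less_imp_le)
  moreover have "equivalent_to_conic \<K> (sum_vars N m) ?S"
    using assms(1) data by (rule equivalent_to_conic_sum_system)
  moreover have "proj_tgx ?S \<subseteq> field_set \<X> (\<lambda>x. \<Sum>k=1..N. \<alpha> k *\<^sub>R F k x)"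
  proof (intro subrelI, clarify)
    fix t g x assume "(t, g, x) \<in> proj_tgx ?S"
    then obtain \<tau> \<gamma> where *: "\<forall>k\<in>{1..N}. (\<tau> k, \<gamma> k, x) \<in> proj_tgx (?C k)"
      and eqs: "g = (\<Sum>k=1..N. \<alpha> k *\<^sub>R \<gamma> k)" "t = (\<Sum>k=1..N. \<alpha> k * \<tau> k)"
      unfolding mem_proj_sum_system by blast
    have "(\<tau> k, \<gamma> k, x) \<in> field_set \<X> (F k)" if "k \<in> {1..N}" for k
      using * pre[OF that] that unfolding pre_representation_def by blast
    then show "(t, g, x) \<in> field_set \<X> (\<lambda>x. \<Sum>k=1..N. \<alpha> k *\<^sub>R F k x)"
      unfolding eqs using one pos by (intro field_set_sum) (auto simp: less_imp_le)
  qed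
  moreover have "(t', g, x) \<in> proj_tgx ?S" if mem: "(t, g, x) \<in> proj_tgx ?S" and le: "t' \<ge> t"
    for t g x t'
  proof -
    obtain \<tau> \<gamma> where *: "\<forall>k\<in>{1..N}. (\<tau> k, \<gamma> k, x) \<in> proj_tgx (?C k)"
      and eqs: "g = (\<Sum>k=1..N. \<alpha> k *\<^sub>R \<gamma> k)" "t = (\<Sum>k=1..N. \<alpha> k * \<tau> k)"
      using mem unfolding mem_proj_sum_system by blast
    \<comment> \<open>The whole excess goes into the first scalar, divided by its weight so that the
      weighted sum grows by exactly \<open>t' - t\<close>. Upward closure of the given projections
      admits the new scalars.\<close>
    define \<tau>' where "\<tau>' k = \<tau> k + (if k = 1 then (t' - t) / \<alpha> 1 else 0)" for k
    have "\<alpha> 1 > 0"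
      using pos one by blast
    have "\<tau>' k \<ge> \<tau> k" for k
      using \<open>\<alpha> 1 > 0\<close> le by (simp add: \<tau>'_def)
    then have "\<forall>k\<in>{1..N}. (\<tau>' k, \<gamma> k, x) \<in> proj_tgx (?C k)"
      using * pre unfolding pre_representation_def by blast
    moreover have "(\<Sum>k=1..N. \<alpha> k * \<tau>' k) =
        (\<Sum>k=1..N. \<alpha> k * \<tau> k + (if k = 1 then t' - t else 0))"
      using \<open>\<alpha> 1 > 0\<close>
      by (intro sum.cong) (auto simp: \<tau>'_def distrib_left)
    then have "t' = (\<Sum>k=1..N. \<alpha> k * \<tau>' k)"
      using one eqs(2) by (simp add: sum.distrib)
    ultimately show ?thesis
      unfolding mem_proj_sum_system using eqs(1) by blast
  qed
  ultimately show ?thesis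
    unfolding pre_representation_def by blast
qed

section \<open>Conditions (ii) and (ii') for the weighted sum\<close>

theorem mainTheorem17:
  fixes \<K> :: "(nat \<times> rvec set) set"
    and \<X> :: "'e::euclidean_space set"
    and N :: nat
    and F :: "nat \<Rightarrow> 'e \<Rightarrow> 'e"
    and \<alpha> :: "nat \<Rightarrow> real"
    and n m :: "nat \<Rightarrow> nat"
    and K :: "nat \<Rightarrow> rvec set"
    and X G :: "nat \<Rightarrow> 'e \<Rightarrow> rvec"
    and T a :: "nat \<Rightarrow> rvec"
    and U :: "nat \<Rightarrow> rvec \<Rightarrow> rvec"
  assumes "cone_family \<K>"
    and "\<X> \<noteq> {}" and "convex \<X>"
    and "N \<ge> 1"
    and "\<And>k. k \<in> {1..N} \<Longrightarrow> continuous_on \<X> (F k)"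
    and "\<And>k. k \<in> {1..N} \<Longrightarrow> monotone_field \<X> (F k)"
    and "\<And>k. k \<in> {1..N} \<Longrightarrow> \<alpha> k > 0"
    and "\<And>k. k \<in> {1..N} \<Longrightarrow>
           conic_data \<K> (Rn (m k)) (n k) (K k) (X k) (G k) (T k) (U k) (a k)"
  shows "((\<forall>k\<in>{1..N}. K_representation \<K> \<X> (F k) (Rn (m k))
              (conic_solutions (Rn (m k)) (K k) (X k) (G k) (T k) (U k) (a k))) \<longrightarrow>
          K_representation \<K> \<X> (\<lambda>x. \<Sum>k=1..N. \<alpha> k *\<^sub>R F k x) (sum_vars N m)
              (sum_system N \<alpha> m K X G T U a)) \<and>
         ((\<forall>k\<in>{1..N}. almost_K_representation \<K> \<X> (F k) (Rn (m k))
              (conic_solutions (Rn (m k)) (K k) (X k) (G k) (T k) (U k) (a k))) \<longrightarrow>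
          almost_K_representation \<K> \<X> (\<lambda>x. \<Sum>k=1..N. \<alpha> k *\<^sub>R F k x) (sum_vars N m)
              (sum_system N \<alpha> m K X G T U a))"
proof (intro conjI impI)
  let ?C = "\<lambda>k. conic_solutions (Rn (m k)) (K k) (X k) (G k) (T k) (U k) (a k)"
  let ?S = "sum_system N \<alpha> m K X G T U a"
  let ?F = "\<lambda>x. \<Sum>k=1..N. \<alpha> k *\<^sub>R F k x"
  have inner: "?F x \<bullet> x = (\<Sum>k=1..N. \<alpha> k * (F k x \<bullet> x))" for x
    by (simp add: inner_sum_left)
  have pre: "pre_representation \<K> \<X> ?F (sum_vars N m) ?S"
    if "\<And>k. k \<in> {1..N} \<Longrightarrow> pre_representation \<K> \<X> (F k) (Rn (m k)) (?C k)"
    using pre_representation_sum_system[OF assms(1,4,7,8) that] .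
  {
    assume *: "\<forall>k\<in>{1..N}. K_representation \<K> \<X> (F k) (Rn (m k)) (?C k)"
    have "(?F x \<bullet> x, ?F x, x) \<in> proj_tgx ?S" if "x \<in> \<X>" for x
    proof -
      \<comment> \<open>The points supplied by (ii) for the summands serve as witnesses; their
        weighted sums are the required values by \<open>inner\<close>.\<close>
      have "\<forall>k\<in>{1..N}. (F k x \<bullet> x, F k x, x) \<in> proj_tgx (?C k)"
        using * that unfolding K_representation_def by blast
      then show ?thesis
        unfolding mem_proj_sum_system using inner[of x]
        by (intro exI[of _ "\<lambda>k. F k x \<bullet> x"] exI[of _ "\<lambda>k. F k x"] conjI refl)
    qed
    then show "K_representation \<K> \<X> ?F (sum_vars N m) ?S"
      using * pre unfolding K_representation_def by blast
  next
    assume *: "\<forall>k\<in>{1..N}. almost_K_representation \<K> \<X> (F k) (Rn (m k)) (?C k)"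
    have "(t, ?F x, x) \<in> proj_tgx ?S" if "x \<in> \<X>" "t > ?F x \<bullet> x" for t x
    proof -
      define A where "A = (\<Sum>k=1..N. \<alpha> k)"
      have "A > 0"
        unfolding A_def using assms(4,7) by (intro sum_pos) auto
      \<comment> \<open>Condition (ii') needs a strict excess in every summand, so the surplus
        cannot be put into one index as for (i). It is spread equally: adding \<open>d\<close> to
        every scalar raises the weighted sum by \<open>A * d\<close>, the full surplus.\<close>
      define d where "d = (t - ?F x \<bullet> x) / A"
      have "d > 0"
        unfolding d_def using \<open>A > 0\<close> that(2) by simp
      then have "\<forall>k\<in>{1..N}. (F k x \<bullet> x + d, F k x, x) \<in> proj_tgx (?C k)"
        using * that(1) unfolding almost_K_representation_def by fastforce
      moreover have "(\<Sum>k=1..N. \<alpha> k * (F k x \<bullet> x + d)) = ?F x \<bullet> x + A * d"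
        unfolding inner A_def by (simp add: distrib_left sum.distrib sum_distrib_right)
      then have "t = (\<Sum>k=1..N. \<alpha> k * (F k x \<bullet> x + d))"
        using \<open>A > 0\<close> by (simp add: d_def)
      ultimately show ?thesis
        unfolding mem_proj_sum_system
        by (intro exI[of _ "\<lambda>k. F k x \<bullet> x + d"] exI[of _ "\<lambda>k. F k x"] conjI refl)
    qed
    then show "almost_K_representation \<K> \<X> ?F (sum_vars N m) ?S"
      using * pre unfolding almost_K_representation_def by blast
  }
qed

end
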